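(* Let $\Delta\subseteq 2^{[n]}$ be a simplicial complex with $m\ge 2$ facets. Then the code $\mathcal S_\Delta=(\Delta\ast(n+1))\cup\{[n]\}\subseteq 2^{[n+1]}$ is intersection complete, has exactly $m+1$ maximal codewords, and $\operatorname{odim}(\mathcal S_\Delta)=m$.
   Context: A code is a set of subsets of $[n]$ (codewords); by convention every code contains $\emptyset$. A code is intersection complete if the intersection of any two codewords is a codeword. A simplicial complex $\Delta\subseteq 2^{[n]}$ is a code closed under taking subsets; its facets are its maximal members. The cone over $\Delta$ with apex $n+1$ is $\Delta\ast(n+1)=\{\sigma\subseteq[n+1] : \sigma\setminus\{n+1\}\in\Delta\}$. For $\mathcal U=\{U_1,\dots,U_N\}$ subsets of $\mathbb R^d$, $U_\sigma=\bigcap_{i\in\sigma}U_i$ ($U_\emptyset=\mathbb R^d$) and $\operatorname{code}(\mathcal U)=\{\sigma\subseteq[N] : U_\sigma\setminus\bigcup_{j\notin\sigma}U_j\neq\emptyset\}$. $\operatorname{odim}(\mathcal C)$ is the least $d$ such that $\mathcal C=\operatorname{code}(\mathcal U)$ for some collection of (possibly empty) convex open sets in $\mathbb R^d$, or $\infty$ if none exists. *)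

theory Defs
  imports "HOL-Analysis.Analysis"
begin

definition is_code :: "nat \<Rightarrow> nat set set \<Rightarrow> bool" where
  "is_code n C \<longleftrightarrow> C \<subseteq> Pow {1..n} \<and> {} \<in> C"

definition intersection_complete :: "nat set set \<Rightarrow> bool" where
  "intersection_complete C \<longleftrightarrow> (\<forall>\<sigma>\<in>C. \<forall>\<tau>\<in>C. \<sigma> \<inter> \<tau> \<in> C)"

definition maximal_codewords :: "nat set set \<Rightarrow> nat set set" where
  "maximal_codewords C = {\<sigma> \<in> C. \<forall>\<tau>\<in>C. \<sigma> \<subseteq> \<tau> \<longrightarrow> \<tau> = \<sigma>}"

definition simplicial_complex_on :: "nat \<Rightarrow> nat set set \<Rightarrow> bool" where
  "simplicial_complex_on n \<Delta> \<longleftrightarrow> is_code n \<Delta> \<and> (\<forall>\<sigma>\<in>\<Delta>. \<forall>\<tau>. \<tau> \<subseteq> \<sigma> \<longrightarrow> \<tau> \<in> \<Delta>)"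

abbreviation facets :: "nat set set \<Rightarrow> nat set set" where
  "facets \<Delta> \<equiv> maximal_codewords \<Delta>"

definition cone_over :: "nat \<Rightarrow> nat set set \<Rightarrow> nat set set" where
  "cone_over n \<Delta> = {\<sigma>. \<sigma> \<subseteq> {1..n+1} \<and> \<sigma> - {n+1} \<in> \<Delta>}"

definition S_code :: "nat \<Rightarrow> nat set set \<Rightarrow> nat set set" where
  "S_code n \<Delta> = cone_over n \<Delta> \<union> {{1..n}}"

text \<open>
  The dimension \<open>d\<close> has to be a variable, so \<open>\<real>\<^sup>d\<close> is the library's \<^const>\<open>Euclidean_space\<close> \<open>d\<close>:
  the real sequences vanishing from index \<open>d\<close> on, with the usual topology of \<open>\<real>\<^sup>d\<close>. The function
  type is not an instance of \<^class>\<open>real_vector\<close>, so convexity is spelled out coordinatewise.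
\<close>

definition convex_seq :: "(nat \<Rightarrow> real) set \<Rightarrow> bool" where
  "convex_seq A \<longleftrightarrow>
     (\<forall>x\<in>A. \<forall>y\<in>A. \<forall>u\<ge>0. \<forall>v\<ge>0. u + v = 1 \<longrightarrow> (\<lambda>i. u * x i + v * y i) \<in> A)"

definition common_part :: "nat \<Rightarrow> (nat \<Rightarrow> (nat \<Rightarrow> real) set) \<Rightarrow> nat set \<Rightarrow> (nat \<Rightarrow> real) set" where
  "common_part d U \<sigma> = topspace (Euclidean_space d) \<inter> (\<Inter>i\<in>\<sigma>. U i)"

definition code_of :: "nat \<Rightarrow> nat \<Rightarrow> (nat \<Rightarrow> (nat \<Rightarrow> real) set) \<Rightarrow> nat set set" where
  "code_of d N U =
     {\<sigma>. \<sigma> \<subseteq> {1..N} \<and> common_part d U \<sigma> - (\<Union>j\<in>{1..N} - \<sigma>. U j) \<noteq> {}}"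

definition open_convex_realizable :: "nat \<Rightarrow> nat set set \<Rightarrow> bool" where
  "open_convex_realizable d C \<longleftrightarrow>
     (\<exists>N U. (\<forall>i\<in>{1..N}. openin (Euclidean_space d) (U i) \<and> convex_seq (U i)) \<and>
            C = code_of d N U)"

text \<open>The infimum of the empty set in \<^typ>\<open>enat\<close> is \<open>\<infinity>\<close>.\<close>

definition odim :: "nat set set \<Rightarrow> enat" where
  "odim C = Inf {enat d | d. open_convex_realizable d C}"

end

theory Submission
  imports Defs
begin

text \<open>
  Lower bound: let \<open>V\<^sub>F\<close> be the intersection of the sets indexed by a facet \<open>F\<close>. Two different \<open>V\<^sub>F\<close>
  meet exactly in \<open>V\<close>, the intersection of the first \<open>n\<close> sets, and the convex set \<open>U\<close> with index
  \<open>n + 1\<close> meets every \<open>V\<^sub>F\<close> but not \<open>V\<close>. Take \<open>p\<^sub>F \<in> U \<inter> V\<^sub>F\<close> and \<open>v \<in> V\<close>. If there are more facets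
  than dimensions, the vectors \<open>p\<^sub>F - v\<close> are linearly dependent; the points with positive
  coefficient average to some \<open>z \<in> U\<close>. As \<open>z\<close> is not in the closure of \<open>V\<close>, there is a ball inside
  \<open>V\<close> whose boundary contains a point \<open>b \<notin> V\<close> and whose tangent hyperplane at \<open>b\<close> separates \<open>z\<close> from
  \<open>V\<close>. The dependence then puts two of the points \<open>p\<^sub>F\<close>, with coefficients of opposite sign, strictly beyond
  that hyperplane. A segment from such a point through \<open>b\<close> enters the ball, so \<open>b\<close> lies in both sets
  \<open>V\<^sub>F\<close> and hence in \<open>V\<close>, a contradiction.

  Upper bound: number the facets \<open>F\<^sub>j\<close> and, in \<open>\<real>\<^sup>m\<close>, let \<open>U\<^sub>i\<close> be given by \<open>x\<^sub>j > 0\<close> for all \<open>j\<close> with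
  \<open>i \<notin> F\<^sub>j\<close>, and \<open>U\<^sub>n\<^sub>+\<^sub>1\<close> by a negative coordinate sum. The codewords are \<open>{1..n}\<close> and
  intersections of facets, with or without \<open>n + 1\<close>; cutting off half-spaces adds the other faces.
\<close>

section \<open>Linear dependence and convex combinations in coordinates\<close>

text \<open>Gaussian elimination, by induction on the number of equations. With \<open>e\<close>
  read as a coordinate, it yields a linear dependence of more than \<open>k\<close> vectors in
  \<open>k\<close> coordinates.\<close>

lemma homogeneous_system_nontrivial:
  fixes a :: "nat \<Rightarrow> 'j \<Rightarrow> real"
  assumes "finite J" "k < card J"
  shows "\<exists>l. (\<exists>j\<in>J. l j \<noteq> 0) \<and> (\<forall>e<k. (\<Sum>j\<in>J. l j * a e j) = 0)"
  using assms
proof (induction k arbitrary: J a)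
  case 0
  then obtain j where "j \<in> J" by fastforce
  then show ?case by (intro exI[of _ "\<lambda>_. 1"]) auto
next
  case (Suc k)
  show ?case
  proof (cases "\<exists>j\<in>J. a k j \<noteq> 0")
    case False
    obtain l where l: "\<exists>j\<in>J. l j \<noteq> 0" "\<forall>e<k. (\<Sum>j\<in>J. l j * a e j) = 0"
      using Suc.IH[of J a] Suc.prems by auto
    have "(\<Sum>j\<in>J. l j * a k j) = 0"
      using False by (intro sum.neutral) auto
    then show ?thesis using l by (metis less_Suc_eq)
  next
    case True
    then obtain j0 where j0: "j0 \<in> J" "a k j0 \<noteq> 0" by auto
    let ?J = "J - {j0}"
    \<comment> \<open>A multiple of equation \<open>k\<close> is subtracted so that the pivot
      unknown \<open>j0\<close> drops out.\<close>
    define a' where "a' e j = a e j - a e j0 * a k j / a k j0" for e j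
    have "k < card ?J" using Suc.prems j0 by auto
    then obtain l where l: "\<exists>j\<in>?J. l j \<noteq> 0" "\<forall>e<k. (\<Sum>j\<in>?J. l j * a' e j) = 0"
      using Suc.IH[of ?J a'] Suc.prems by auto
    \<comment> \<open>Back substitution: \<open>- s\<close> is the value at \<open>j0\<close> that
      equation \<open>k\<close> demands.\<close>
    define s where "s = (\<Sum>j\<in>?J. l j * a k j) / a k j0"
    define l' where "l' = l(j0 := - s)"
    have sum': "(\<Sum>j\<in>J. l' j * a e j) = (\<Sum>j\<in>?J. l j * a e j) - s * a e j0" for e
      using Suc.prems j0 by (simp add: sum.remove[of J j0] l'_def)
    have "(\<Sum>j\<in>J. l' j * a e j) = 0" if "e < Suc k" for e
    proof (cases "e = k")
      case True
      then show ?thesis using j0 by (simp add: sum' s_def)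
    next
      case False
      then have "(\<Sum>j\<in>?J. l j * a' e j) = 0" using l that by auto
      moreover have "(\<Sum>j\<in>?J. l j * a' e j) = (\<Sum>j\<in>?J. l j * a e j) - s * a e j0"
        by (simp add: a'_def s_def right_diff_distrib sum_subtractf sum_divide_distrib sum_distrib_left sum_distrib_right mult_ac)
      ultimately show ?thesis by (simp add: sum')
    qed
    moreover have "\<exists>j\<in>J. l' j \<noteq> 0" using l by (auto simp: l'_def)
    ultimately show ?thesis by blast
  qed
qed

text \<open>One point is split off and the remaining weights are divided by their sum
  \<open>s\<close>, which is positive because all weights are.\<close>

lemma convex_seq_sum:
  assumes "convex_seq A" "finite I" "I \<noteq> {}"
    and "\<And>i. i \<in> I \<Longrightarrow> p i \<in> A" "\<And>i. i \<in> I \<Longrightarrow> 0 < w i" "sum w I = 1"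
  shows "(\<lambda>e. \<Sum>i\<in>I. w i * p i e) \<in> A"
  using assms(2-)
proof (induction I arbitrary: w rule: finite_ne_induct)
  case (singleton i)
  then show ?case by simp
next
  case (insert i I)
  define s where "s = sum w I"
  have s: "s > 0" using insert unfolding s_def by (intro sum_pos) auto
  have "sum (\<lambda>i. w i / s) I = 1" using s by (simp add: s_def flip: sum_divide_distrib)
  then have "(\<lambda>e. \<Sum>i\<in>I. w i / s * p i e) \<in> A"
    using insert s by (intro insert.IH) auto
  moreover have "p i \<in> A" "w i > 0" "w i + s = 1" using insert by (auto simp: s_def)
  ultimately have "(\<lambda>e. w i * p i e + s * (\<Sum>i\<in>I. w i / s * p i e)) \<in> A"
    using assms(1) s unfolding convex_seq_def by force
  moreover have "s * (\<Sum>i\<in>I. w i / s * p i e) = (\<Sum>i\<in>I. w i * p i e)" for e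
    using s by (simp add: sum_distrib_left)
  ultimately show ?case using insert by simp
qed

section \<open>Open convex sets and nearest points in Euclidean space\<close>

definition open_convex :: "nat \<Rightarrow> (nat \<Rightarrow> real) set \<Rightarrow> bool" where
  "open_convex d A \<longleftrightarrow> openin (Euclidean_space d) A \<and> convex_seq A"

text \<open>As a subspace of the function space, the topology becomes accessible to facts about
  \<open>open\<close> and \<open>compact\<close>.\<close>

lemma Euclidean_space_eq_top_of_set:
  "Euclidean_space d = top_of_set {x. \<forall>i\<ge>d. x i = 0}"
  unfolding Euclidean_space_def euclidean_product_topology ..

declare topspace_Euclidean_space [simp]

lemma open_convex_half_space:
  "open_convex d {x \<in> topspace (Euclidean_space d). (\<Sum>i<d. a i * x i) < k}"
  unfolding open_convex_def
proof
  have "open {x. (\<Sum>i<d. a i * x i) < k}"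
    by (intro open_Collect_less continuous_intros continuous_on_product_coordinates)
  then show "openin (Euclidean_space d) {x \<in> topspace (Euclidean_space d). (\<Sum>i<d. a i * x i) < k}"
    unfolding Euclidean_space_eq_top_of_set
    by (auto simp: openin_open)
  show "convex_seq {x \<in> topspace (Euclidean_space d). (\<Sum>i<d. a i * x i) < k}"
    unfolding convex_seq_def
  proof (intro ballI allI impI)
    fix x y and u v :: real
    assume xy: "x \<in> {x \<in> topspace (Euclidean_space d). (\<Sum>i<d. a i * x i) < k}"
      "y \<in> {x \<in> topspace (Euclidean_space d). (\<Sum>i<d. a i * x i) < k}"
      and uv: "0 \<le> u" "0 \<le> v" "u + v = 1"
    have "(\<Sum>i<d. a i * (u * x i + v * y i)) = u * (\<Sum>i<d. a i * x i) + v * (\<Sum>i<d. a i * y i)"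
      by (simp add: algebra_simps sum.distrib sum_distrib_left)
    also have "\<dots> < k"
      using convex_bound_lt[of "\<Sum>i<d. a i * x i" k "\<Sum>i<d. a i * y i" u v] xy uv by simp
    finally show "(\<lambda>i. u * x i + v * y i) \<in> {x \<in> topspace (Euclidean_space d). (\<Sum>i<d. a i * x i) < k}"
      using xy by simp
  qed
qed

text \<open>Intersecting with the whole space gives the empty family its intended meaning.\<close>

lemma open_convex_Inter:
  assumes "finite I" "\<And>i. i \<in> I \<Longrightarrow> open_convex d (A i)"
  shows "open_convex d (topspace (Euclidean_space d) \<inter> (\<Inter>i\<in>I. A i))"
proof -
  have "convex_seq (topspace (Euclidean_space d) \<inter> (\<Inter>i\<in>I. A i))"
    using assms(2) unfolding open_convex_def convex_seq_def by auto
  moreover have "openin (Euclidean_space d) (topspace (Euclidean_space d) \<inter> (\<Inter>i\<in>I. A i))"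
    using assms by (subst Int_commute, intro openin_INT) (auto simp: open_convex_def)
  ultimately show ?thesis by (simp add: open_convex_def)
qed

text \<open>Squared, so that the identities about it are polynomial in the coordinates.\<close>

definition sq_dist :: "nat \<Rightarrow> (nat \<Rightarrow> real) \<Rightarrow> (nat \<Rightarrow> real) \<Rightarrow> real" where
  "sq_dist d x y = (\<Sum>i<d. (x i - y i)\<^sup>2)"

lemma sq_dist_nonneg: "sq_dist d x y \<ge> 0"
  by (simp add: sq_dist_def sum_nonneg)

lemma sq_dist_pos:
  assumes "x \<in> topspace (Euclidean_space d)" "y \<in> topspace (Euclidean_space d)" "x \<noteq> y"
  shows "sq_dist d x y > 0"
proof -
  obtain i where i: "x i \<noteq> y i" using assms by (meson ext)
  with assms have "i < d" by (metis (mono_tags, lifting) mem_Collect_eq not_le topspace_Euclidean_space)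
  then show ?thesis unfolding sq_dist_def using i by (intro sum_pos2[of _ i]) auto
qed

lemma abs_le_sqrt_sq_dist: "i < d \<Longrightarrow> \<bar>x i - y i\<bar> \<le> sqrt (sq_dist d x y)"
  unfolding sq_dist_def
  by (intro real_le_rsqrt) (auto intro!: member_le_sum)

text \<open>The points at most as far from \<open>c\<close> as \<open>w\<close> lie in a compact
  box, so the distance attains its minimum outside \<open>V\<close> at some \<open>b\<close>. The
  open ball around \<open>c\<close> through \<open>b\<close> then lies in \<open>V\<close>.\<close>

lemma nearest_point_outside:
  assumes V: "openin (Euclidean_space d) V"
    and c: "c \<in> topspace (Euclidean_space d)" and w: "w \<in> topspace (Euclidean_space d) - V"
  obtains b where "b \<in> topspace (Euclidean_space d) - V" "sq_dist d c b \<le> sq_dist d c w"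
    "\<And>x. x \<in> topspace (Euclidean_space d) \<Longrightarrow> sq_dist d c x < sq_dist d c b \<Longrightarrow> x \<in> V"
proof -
  define r where "r = sqrt (sq_dist d c w)"
  define B where "B = PiE UNIV (\<lambda>i. if i < d then {c i - r .. c i + r} else {0::real})"
  have "compactin (product_topology (\<lambda>i. euclidean) UNIV) B"
    unfolding B_def compactin_PiE by auto
  then have "compact B" by (simp add: euclidean_product_topology)
  obtain W where W: "open W" "V = topspace (Euclidean_space d) \<inter> W"
    using V unfolding Euclidean_space_eq_top_of_set by (auto simp: openin_open)
  have in_B: "x \<in> B" if "x \<in> topspace (Euclidean_space d)" "sq_dist d c x \<le> sq_dist d c w" for x
  proof -
    have "\<bar>c i - x i\<bar> \<le> r" if "i < d" for i
      using abs_le_sqrt_sq_dist[OF that, of c x] \<open>sq_dist d c x \<le> sq_dist d c w\<close>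
      unfolding r_def by (meson order_trans real_sqrt_le_mono)
    then show ?thesis using that unfolding B_def by (force simp: abs_le_iff)
  qed
  have B_sub: "B \<subseteq> topspace (Euclidean_space d)"
    by (auto simp: B_def PiE_iff dest!: spec split: if_splits)
  have "compact (B - W)" using \<open>compact B\<close> W by (simp add: compact_diff)
  moreover have "w \<in> B - W" using w W in_B[of w] by auto
  moreover have "continuous_on (B - W) (\<lambda>x. sq_dist d c x)"
    unfolding sq_dist_def
    by (intro continuous_intros continuous_on_subset[OF continuous_on_product_coordinates]) auto
  ultimately obtain b where b: "b \<in> B - W" "\<And>x. x \<in> B - W \<Longrightarrow> sq_dist d c b \<le> sq_dist d c x"
    using continuous_attains_inf[of "B - W" "\<lambda>x. sq_dist d c x"] by blast
  have bw: "sq_dist d c b \<le> sq_dist d c w" using b \<open>w \<in> B - W\<close> by blast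
  show ?thesis
  proof
    show "b \<in> topspace (Euclidean_space d) - V" using b W B_sub by blast
    show "sq_dist d c b \<le> sq_dist d c w" by fact
    fix x assume x: "x \<in> topspace (Euclidean_space d)" "sq_dist d c x < sq_dist d c b"
    then have "x \<in> B" using in_B bw by force
    then show "x \<in> V" using b(2)[of x] x W by force
  qed
qed

section \<open>Flexible sunflowers of convex open sets\<close>

text \<open>Its zero set is the tangent hyperplane at \<open>b\<close> to the sphere around
  \<open>c\<close> through \<open>b\<close>; it is positive on the side of \<open>c\<close>.\<close>

definition tangent_form :: "nat \<Rightarrow> (nat \<Rightarrow> real) \<Rightarrow> (nat \<Rightarrow> real) \<Rightarrow> (nat \<Rightarrow> real) \<Rightarrow> real" where
  "tangent_form d c b x = (\<Sum>i<d. (x i - b i) * (c i - b i))"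

lemma convex_seqD:
  "convex_seq A \<Longrightarrow> x \<in> A \<Longrightarrow> y \<in> A \<Longrightarrow> 0 \<le> u \<Longrightarrow> 0 \<le> v \<Longrightarrow> u + v = 1 \<Longrightarrow>
    (\<lambda>i. u * x i + v * y i) \<in> A"
  by (simp add: convex_seq_def)

text \<open>From a point \<open>x\<close> strictly beyond the tangent hyperplane, the segment
  through \<open>b\<close> continues into the ball. Then \<open>b\<close> lies between two points of
  \<open>A\<close>, against \<open>b \<notin> A\<close>.\<close>

lemma tangent_form_nonneg:
  assumes A: "convex_seq A" "A \<subseteq> topspace (Euclidean_space d)"
    and b: "b \<in> topspace (Euclidean_space d)" "b \<notin> A"
    and ball: "\<And>x. x \<in> topspace (Euclidean_space d) \<Longrightarrow> sq_dist d c x < sq_dist d c b \<Longrightarrow> x \<in> A"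
    and x: "x \<in> A"
  shows "tangent_form d c b x \<ge> 0"
proof (rule ccontr)
  let ?h = "tangent_form d c b x"
  assume "\<not> ?h \<ge> 0"
  then have h: "?h < 0" by simp
  \<comment> \<open>Small enough for the linear term \<open>2 * ?h\<close> to dominate the quadratic
    one; the \<open>+ 1\<close> makes the denominator positive at once.\<close>
  define t where "t = - ?h / (sq_dist d b x + 1)"
  have pos: "sq_dist d b x + 1 > 0" using sq_dist_nonneg[of d b x] by linarith
  then have t: "t > 0" using h by (simp add: t_def divide_neg_pos)
  define y where "y = (\<lambda>i. b i + t * (b i - x i))"
  have "t * sq_dist d b x < - 2 * ?h"
  proof -
    have "t * sq_dist d b x \<le> t * (sq_dist d b x + 1)" using t by simp
    also have "\<dots> = - ?h" using pos by (simp add: t_def)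
    finally show ?thesis using h by linarith
  qed
  then have "t * (2 * ?h + t * sq_dist d b x) < 0"
    using t by (simp add: mult_pos_neg)
  moreover have "sq_dist d c y = sq_dist d c b + t * (2 * ?h + t * sq_dist d b x)"
    unfolding sq_dist_def tangent_form_def y_def
    by (simp add: sum_distrib_left flip: sum.distrib)
       (intro sum.cong refl, simp add: algebra_simps power2_eq_square)
  moreover have "y \<in> topspace (Euclidean_space d)"
    using b A x by (auto simp: y_def)
  ultimately have "y \<in> A" using ball by simp
  then have "(\<lambda>i. 1 / (1 + t) * y i + t / (1 + t) * x i) \<in> A"
    using A(1) x t by (intro convex_seqD) (auto simp flip: add_divide_distrib)
  moreover have "(\<lambda>i. 1 / (1 + t) * y i + t / (1 + t) * x i) = b"
  proof
    fix i
    have "1 / (1 + t) * y i + t / (1 + t) * x i = (y i + t * x i) / (1 + t)"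
      by (simp add: add_divide_distrib)
    also have "y i + t * x i = b i * (1 + t)" by (simp add: y_def algebra_simps)
    also have "\<dots> / (1 + t) = b i" using t by simp
    finally show "1 / (1 + t) * y i + t / (1 + t) * x i = b i" .
  qed
  ultimately show False using b by simp
qed

text \<open>A discrete intermediate value principle, for finding where a sampled segment leaves
  \<open>V\<close>.\<close>

lemma ex_adjacent_change:
  fixes P :: "nat \<Rightarrow> bool"
  assumes "P 0" "\<not> P n"
  obtains k where "k < n" "P k" "\<not> P (Suc k)"
proof -
  have "P j" if "j \<le> n" "\<forall>k<n. P k \<longrightarrow> P (Suc k)" for j
    using that assms(1) by (induction j) auto
  then show ?thesis using assms(2) that by blast
qed

text \<open>Sample the segment from \<open>v\<close> to \<open>z\<close> finely; \<open>c\<close> is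
  a sample point in \<open>V\<close> whose successor is outside, and \<open>b\<close> is a point
  outside \<open>V\<close> nearest to \<open>c\<close>. The form is affine and equals
  \<open>R\<^sup>2\<close> at \<open>c\<close>, but is at least \<open>r * R / 2\<close> at
  \<open>v\<close>. With \<open>R\<close> small against \<open>r\<close>, it must be negative at
  \<open>z\<close>.\<close>

lemma separating_tangent_ball:
  assumes V: "openin (Euclidean_space d) V" "convex_seq V" and v: "v \<in> V"
    and U: "openin (Euclidean_space d) U" and z: "z \<in> U" and UV: "U \<inter> V = {}"
  obtains b c where "b \<in> topspace (Euclidean_space d) - V"
    "\<And>x. x \<in> topspace (Euclidean_space d) \<Longrightarrow> sq_dist d c x < sq_dist d c b \<Longrightarrow> x \<in> V"
    "tangent_form d c b z < 0"
proof -
  let ?E = "topspace (Euclidean_space d)"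
  have VE: "V \<subseteq> ?E" and UE: "U \<subseteq> ?E" using V U openin_subset by blast+
  have vE: "v \<in> ?E" and zE: "z \<in> ?E" using VE UE v z by blast+
  define L where "L = sq_dist d v z"
  have L: "L > 0" unfolding L_def using UV v z vE zE by (intro sq_dist_pos) auto
  have "z \<in> ?E - V" using zE UV z by blast
  then obtain b0 where b0: "b0 \<in> ?E - V" "\<And>x. x \<in> ?E \<Longrightarrow> sq_dist d v x < sq_dist d v b0 \<Longrightarrow> x \<in> V"
    by (rule nearest_point_outside[OF V(1) vE], intro that)
  define r where "r = sqrt (sq_dist d v b0)"
  have r: "r > 0" unfolding r_def using b0 v vE by (auto intro!: sq_dist_pos)
  have r2: "r\<^sup>2 = sq_dist d v b0" unfolding r_def by (simp add: sq_dist_nonneg)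
  have "v \<in> ?E - U" using vE UV v by blast
  then obtain b1 where b1: "b1 \<in> ?E - U" "sq_dist d z b1 \<le> sq_dist d z v"
      "\<And>x. x \<in> ?E \<Longrightarrow> sq_dist d z x < sq_dist d z b1 \<Longrightarrow> x \<in> U"
    by (rule nearest_point_outside[OF U zE], intro that)
  have b1_pos: "sq_dist d z b1 > 0" using b1 z zE by (intro sq_dist_pos) auto
  have zv: "sq_dist d z v = L" unfolding L_def sq_dist_def by (simp add: power2_commute)
  \<comment> \<open>Chosen so that \<open>seg (1 - k)\<close> is still in the ball around
    \<open>z\<close> inside \<open>U\<close>, hence outside \<open>V\<close>. Sampling stops there,
    which keeps \<open>1 - s\<close> at least \<open>k\<close>.\<close>
  define k where "k = sq_dist d z b1 / (2 * L)"
  have k: "k > 0" "k \<le> 1/2" using b1_pos b1(2) L by (simp_all add: k_def zv field_simps)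
  define seg where "seg s = (\<lambda>i. (1 - s) * v i + s * z i)" for s
  have seg_E: "seg s \<in> ?E" for s using vE zE by (auto simp: seg_def)
  have "seg (1 - k) \<in> U"
  proof -
    have "sq_dist d z (seg (1 - k)) = k * (k * sq_dist d z v)"
      unfolding sq_dist_def seg_def sum_distrib_left
      by (intro sum.cong refl) (simp add: algebra_simps power2_eq_square)
    also have "\<dots> = k * (sq_dist d z b1 / 2)" using L by (simp add: zv k_def)
    also have "\<dots> < sq_dist d z b1"
      using k b1_pos mult_right_mono[of k "1/2" "sq_dist d z b1 / 2"] by linarith
    finally show ?thesis using b1(3) seg_E by blast
  qed
  then have end_out: "seg (1 - k) \<notin> V" using UV by blast
  have start_in: "seg 0 \<in> V" using v by (simp add: seg_def)
  \<comment> \<open>Each step is then shorter than \<open>k * r / 2\<close>, and so is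
    \<open>R\<close>.\<close>
  obtain N :: nat where N: "N > 0" "sqrt L / (k * r / 2) < N"
    by (metis reals_Archimedean2 gr0I L k(1) r divide_pos_pos half_gt_zero mult_pos_pos not_less_iff_gr_or_eq of_nat_0 real_sqrt_gt_zero)
  define st where "st j = real j * ((1 - k) / N)" for j
  have "seg (st 0) \<in> V" "seg (st N) \<notin> V" using start_in end_out N by (simp_all add: st_def)
  then obtain j where j: "j < N" "seg (st j) \<in> V" "seg (st (Suc j)) \<notin> V"
    using ex_adjacent_change[of "\<lambda>j. seg (st j) \<in> V" N] by blast
  define s where "s = st j"
  define c where "c = seg s"
  have s0: "s \<ge> 0" using k by (simp add: s_def st_def)
  have "real j * (1 - k) \<le> real N * (1 - k)" using j k by (intro mult_right_mono) auto
  then have s1: "s \<le> 1 - k" using N by (simp add: s_def st_def field_simps)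
  have cV: "c \<in> V" using j by (simp add: c_def s_def)
  have cE: "c \<in> ?E" using cV VE by blast
  have "seg (st (Suc j)) \<in> ?E - V" using j seg_E by blast
  then obtain b where b: "b \<in> ?E - V" "sq_dist d c b \<le> sq_dist d c (seg (st (Suc j)))"
      "\<And>x. x \<in> ?E \<Longrightarrow> sq_dist d c x < sq_dist d c b \<Longrightarrow> x \<in> V"
    by (rule nearest_point_outside[OF V(1) cE], intro that)
  define R where "R = sqrt (sq_dist d c b)"
  have R: "R > 0" unfolding R_def using b cV cE by (auto intro!: sq_dist_pos)
  have R2: "R\<^sup>2 = sq_dist d c b" unfolding R_def by (simp add: sq_dist_nonneg)
  have "R < k * r / 2"
  proof -
    have st_Suc: "st (Suc j) = s + (1 - k) / N"
      by (simp add: s_def st_def distrib_right add_divide_distrib)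
    have "sq_dist d (seg s) (seg (s + e)) = e\<^sup>2 * L" for e
      unfolding sq_dist_def seg_def L_def sum_distrib_left
      by (intro sum.cong refl) (simp add: algebra_simps power2_eq_square)
    then have "sq_dist d c (seg (st (Suc j))) = ((1 - k) / N)\<^sup>2 * L"
      by (simp add: c_def st_Suc)
    also have "\<dots> \<le> (1 / N)\<^sup>2 * L"
      using k L by (intro mult_right_mono power_mono divide_right_mono) auto
    finally have "R \<le> sqrt ((1 / N)\<^sup>2 * L)" unfolding R_def using b(2) by simp
    also have "\<dots> = sqrt L / N" by (simp add: real_sqrt_mult)
    also have "\<dots> < k * r / 2" using N k r by (simp add: field_simps)
    finally show ?thesis .
  qed
  moreover have "k * r / 2 \<le> (1 - s) * (r / 2)" using s1 r by (simp add: mult_right_mono)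
  ultimately have R_less: "R < (1 - s) * (r / 2)" by linarith
  let ?h = "tangent_form d c b"
  have hv: "?h v \<ge> r * R / 2"
  proof -
    \<comment> \<open>Moves \<open>v\<close> by \<open>r / 2\<close> towards the hyperplane; the
      result stays in the ball of radius \<open>r\<close> inside \<open>V\<close>, where the form is
      nonnegative.\<close>
    define t where "t = r / (2 * R)"
    define x where "x = (\<lambda>i. v i - t * (c i - b i))"
    have "sq_dist d v x = t\<^sup>2 * sq_dist d c b"
      unfolding sq_dist_def x_def sum_distrib_left
      by (intro sum.cong refl) (simp add: algebra_simps power2_eq_square)
    also have "\<dots> = r\<^sup>2 / 4" using R by (simp add: t_def power2_eq_square flip: R2)
    also have "\<dots> < sq_dist d v b0" unfolding r2[symmetric] using r by simp
    finally have "x \<in> V" using b0(2) vE cE b(1) by (auto simp: x_def)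
    then have "?h x \<ge> 0"
      using tangent_form_nonneg[of V d b c x] V VE b by blast
    moreover have "?h x = ?h v - t * sq_dist d c b"
      unfolding tangent_form_def sq_dist_def x_def sum_distrib_left
      by (simp flip: sum_subtractf) (intro sum.cong refl, simp add: algebra_simps power2_eq_square)
    moreover have "t * sq_dist d c b = r * R / 2" using R by (simp add: t_def power2_eq_square flip: R2)
    ultimately show ?thesis by simp
  qed
  \<comment> \<open>The affine form evaluated at \<open>c\<close>, which divides the segment from
    \<open>v\<close> to \<open>z\<close> in the ratio given by \<open>s\<close>.\<close>
  have "R\<^sup>2 = (1 - s) * ?h v + s * ?h z"
    unfolding R2 unfolding tangent_form_def sq_dist_def c_def seg_def sum_distrib_left
    by (simp flip: sum.distrib) (intro sum.cong refl, simp add: algebra_simps power2_eq_square)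
  moreover have "(1 - s) * ?h v \<ge> (1 - s) * (r * R / 2)"
    using hv s1 k by (intro mult_left_mono) auto
  moreover have "R\<^sup>2 < (1 - s) * (r * R / 2)"
    using mult_strict_right_mono[OF R_less R] by (simp add: power2_eq_square mult_ac)
  ultimately have "s * ?h z < 0" by linarith
  then have "?h z < 0" using s0 by (simp add: mult_less_0_iff)
  with b show ?thesis using that by blast
qed

text \<open>The \<open>W j\<close> are petals with centre \<open>V\<close>. The tangent form sums to
  a negative number over the positive coefficients, but to a nonnegative one over all of
  \<open>J\<close>. So some index outside \<open>P\<close> contributes positively, which needs a
  negative coefficient and a negative value of the form.\<close>

lemma sunflower_center_meets:
  assumes "finite J" "d < card J"
    and V: "open_convex d V" and v: "v \<in> V"
    and W: "\<And>j. j \<in> J \<Longrightarrow> convex_seq (W j)" "\<And>j. j \<in> J \<Longrightarrow> W j \<subseteq> topspace (Euclidean_space d)"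
    and VW: "\<And>j. j \<in> J \<Longrightarrow> V \<subseteq> W j"
    and WW: "\<And>i j. i \<in> J \<Longrightarrow> j \<in> J \<Longrightarrow> i \<noteq> j \<Longrightarrow> W i \<inter> W j \<subseteq> V"
    and U: "open_convex d U" and p: "\<And>j. j \<in> J \<Longrightarrow> p j \<in> U \<inter> W j"
  shows "U \<inter> V \<noteq> {}"
proof
  assume UV: "U \<inter> V = {}"
  let ?E = "topspace (Euclidean_space d)"
  obtain l0 where l0: "\<exists>j\<in>J. l0 j \<noteq> (0::real)" "\<forall>e<d. (\<Sum>j\<in>J. l0 j * (p j e - v e)) = 0"
    using homogeneous_system_nontrivial[OF assms(1,2), of "\<lambda>e j. p j e - v e"] by blast
  \<comment> \<open>The sign is chosen so that the coefficients have nonnegative sum; this makes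
    \<open>P\<close> nonempty and is used again for the sum over \<open>J\<close>.\<close>
  define l where "l = (if sum l0 J \<ge> 0 then l0 else (\<lambda>j. - l0 j))"
  have l: "\<exists>j\<in>J. l j \<noteq> 0" "\<forall>e<d. (\<Sum>j\<in>J. l j * (p j e - v e)) = 0" "sum l J \<ge> 0"
    using l0 by (auto simp: l_def sum_negf)
  define P where "P = {j \<in> J. l j > 0}"
  have "P \<noteq> {}"
  proof
    assume "P = {}"
    then have "\<And>j. j \<in> J \<Longrightarrow> l j \<le> 0" by (force simp: P_def)
    moreover from this have "sum l J = 0" using l(3) sum_nonpos[of J l] by fastforce
    ultimately show False using l(1) sum_nonneg_eq_0_iff[of J "\<lambda>j. - l j"] assms(1)
      by (auto simp: sum_negf)
  qed
  have "finite P" "P \<subseteq> J" using assms(1) by (auto simp: P_def)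
  define S where "S = sum l P"
  have S: "S > 0" unfolding S_def using \<open>P \<noteq> {}\<close> \<open>finite P\<close>
    by (intro sum_pos) (auto simp: P_def)
  define z where "z = (\<lambda>e. \<Sum>j\<in>P. l j / S * p j e)"
  have "(\<Sum>j\<in>P. l j / S) = 1" using S by (simp add: S_def flip: sum_divide_distrib)
  then have zU: "z \<in> U" unfolding z_def
    using U p S \<open>P \<noteq> {}\<close> \<open>finite P\<close>
    by (intro convex_seq_sum) (auto simp: P_def open_convex_def)
  have V': "openin (Euclidean_space d) V" "convex_seq V" and U': "openin (Euclidean_space d) U"
    using V U by (simp_all add: open_convex_def)
  obtain b c where bc: "b \<in> ?E - V"
    "\<And>x. x \<in> ?E \<Longrightarrow> sq_dist d c x < sq_dist d c b \<Longrightarrow> x \<in> V"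
    and bc_z: "tangent_form d c b z < 0"
    by (rule separating_tangent_ball[OF V' v U' zU UV], rule that)
  let ?h = "tangent_form d c b"
  have VE: "V \<subseteq> ?E" using V openin_subset unfolding open_convex_def by blast
  have hv: "?h v \<ge> 0"
    using tangent_form_nonneg[of V d b c v] V v VE bc unfolding open_convex_def by blast
  \<comment> \<open>The ball lies in \<open>V\<close>, hence in \<open>W j\<close>, so
    \<open>tangent_form_nonneg\<close> applies to the petal in contrapositive form.\<close>
  have in_W: "b \<in> W j" if "j \<in> J" "?h (p j) < 0" for j
    using tangent_form_nonneg[of "W j" d b c "p j"] W[OF that(1)] VW[OF that(1)] p[OF that(1)] bc that(2)
    by force
  have h_diff: "(\<Sum>j\<in>A. l j * ?h (p j)) - sum l A * ?h v
      = (\<Sum>i<d. (\<Sum>j\<in>A. l j * (p j i - v i)) * (c i - b i))" for A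
  proof -
    have "(\<Sum>j\<in>A. l j * ?h (p j)) - sum l A * ?h v = (\<Sum>j\<in>A. l j * (?h (p j) - ?h v))"
      by (simp add: right_diff_distrib sum_subtractf sum_distrib_right)
    also have "\<dots> = (\<Sum>j\<in>A. \<Sum>i<d. l j * (p j i - v i) * (c i - b i))"
      unfolding tangent_form_def
      by (intro sum.cong refl)
        (simp add: sum_distrib_left algebra_simps flip: sum_subtractf)
    also have "\<dots> = (\<Sum>i<d. (\<Sum>j\<in>A. l j * (p j i - v i)) * (c i - b i))"
      by (subst sum.swap) (simp add: sum_distrib_right)
    finally show ?thesis .
  qed
  have "S * ?h z = (\<Sum>j\<in>P. l j * ?h (p j))"
  proof -
    have "(\<Sum>j\<in>P. l j * (p j i - v i)) = S * (z i - v i)" for i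
    proof -
      have "S * z i = (\<Sum>j\<in>P. l j * p j i)" using S by (simp add: z_def sum_distrib_left)
      then show ?thesis by (simp add: S_def right_diff_distrib sum_subtractf sum_distrib_right)
    qed
    then have "(\<Sum>j\<in>P. l j * ?h (p j)) - S * ?h v = (\<Sum>i<d. S * (z i - v i) * (c i - b i))"
      using h_diff[of P] by (simp add: S_def)
    also have "\<dots> = S * (?h z - ?h v)"
      unfolding tangent_form_def
      by (simp add: sum_distrib_left flip: sum_subtractf)
        (intro sum.cong refl, simp add: algebra_simps)
    finally show ?thesis by (simp add: algebra_simps)
  qed
  moreover have "S * ?h z < 0" using S bc_z by (simp add: mult_pos_neg)
  ultimately have neg: "(\<Sum>j\<in>P. l j * ?h (p j)) < 0" by simp
  have "\<exists>i\<in>P. l i * ?h (p i) < 0" using neg by (meson not_le sum_nonneg)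
  then obtain i where i: "i \<in> P" "?h (p i) < 0" by (auto simp: P_def mult_less_0_iff)
  \<comment> \<open>The dependence cancels the linear part of the affine form and leaves only its
    value at \<open>v\<close>.\<close>
  have "(\<Sum>j\<in>J. l j * ?h (p j)) = sum l J * ?h v"
    using h_diff[of J] l(2) by simp
  also have "\<dots> \<ge> 0" using l(3) hv by simp
  finally have "(\<Sum>j\<in>J - P. l j * ?h (p j)) > 0"
    using neg sum.subset_diff[OF \<open>P \<subseteq> J\<close> assms(1), of "\<lambda>j. l j * ?h (p j)"] by simp
  then have "\<exists>j\<in>J - P. l j * ?h (p j) > 0" by (meson not_le sum_nonpos)
  then obtain j where j: "j \<in> J - P" "?h (p j) < 0" by (auto simp: P_def zero_less_mult_iff)
  have "b \<in> W i \<inter> W j" using in_W i j \<open>P \<subseteq> J\<close> by blast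
  then show False using WW[of i j] i j \<open>P \<subseteq> J\<close> bc by blast
qed

section \<open>The code of a simplicial complex\<close>

text \<open>Every point has exactly one codeword, so realizability can be checked point by
  point.\<close>

lemma code_of_eq:
  "code_of d N U = (\<lambda>x. {i \<in> {1..N}. x \<in> U i}) ` topspace (Euclidean_space d)"
proof (intro equalityI subsetI)
  fix \<sigma> assume "\<sigma> \<in> code_of d N U"
  then obtain x where "\<sigma> \<subseteq> {1..N}" "x \<in> topspace (Euclidean_space d)"
      "\<forall>i\<in>\<sigma>. x \<in> U i" "\<forall>i\<in>{1..N} - \<sigma>. x \<notin> U i"
    unfolding code_of_def common_part_def by blast
  moreover from this have "\<sigma> = {i \<in> {1..N}. x \<in> U i}" by blast
  ultimately show "\<sigma> \<in> (\<lambda>x. {i \<in> {1..N}. x \<in> U i}) ` topspace (Euclidean_space d)" by blast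
next
  fix \<sigma> assume "\<sigma> \<in> (\<lambda>x. {i \<in> {1..N}. x \<in> U i}) ` topspace (Euclidean_space d)"
  then show "\<sigma> \<in> code_of d N U"
    unfolding code_of_def common_part_def by blast
qed

context
  fixes n :: nat and \<Delta> :: "nat set set"
  assumes complex: "simplicial_complex_on n \<Delta>" and two_facets: "card (facets \<Delta>) \<ge> 2"
begin

lemma complex_sub: "\<sigma> \<in> \<Delta> \<Longrightarrow> \<sigma> \<subseteq> {1..n}"
  using complex by (auto simp: simplicial_complex_on_def is_code_def)

lemma complex_mono: "\<sigma> \<in> \<Delta> \<Longrightarrow> \<tau> \<subseteq> \<sigma> \<Longrightarrow> \<tau> \<in> \<Delta>"
  using complex by (auto simp: simplicial_complex_on_def)

lemma empty_in_complex: "{} \<in> \<Delta>"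
  using complex by (auto simp: simplicial_complex_on_def is_code_def)

lemma finite_complex: "finite \<Delta>"
  using complex_sub by (intro finite_subset[of \<Delta> "Pow {1..n}"]) blast+

lemma facets_sub: "facets \<Delta> \<subseteq> \<Delta>"
  by (auto simp: maximal_codewords_def)

lemma ex_facet: "\<sigma> \<in> \<Delta> \<Longrightarrow> \<exists>\<tau>\<in>facets \<Delta>. \<sigma> \<subseteq> \<tau>"
proof -
  assume "\<sigma> \<in> \<Delta>"
  then obtain \<tau> where \<tau>: "\<tau> \<in> \<Delta>" "\<sigma> \<subseteq> \<tau>" "\<And>\<rho>. \<rho> \<in> \<Delta> \<Longrightarrow> \<tau> \<subseteq> \<rho> \<Longrightarrow> \<tau> = \<rho>"
    using finite_has_maximal2[OF finite_complex, of \<sigma>] by metis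
  then have "\<tau> \<in> facets \<Delta>" unfolding maximal_codewords_def by blast
  then show ?thesis using \<tau>(2) by blast
qed

lemma apex_notin_facet:
  assumes "\<sigma> \<in> facets \<Delta>" shows "n + 1 \<notin> \<sigma>"
proof -
  have "\<sigma> \<subseteq> {1..n}" using assms facets_sub complex_sub by blast
  then show ?thesis by auto
qed

lemma full_notin_complex: "{1..n} \<notin> \<Delta>"
proof
  assume "{1..n} \<in> \<Delta>"
  then have "facets \<Delta> \<subseteq> {{1..n}}"
    using complex_sub unfolding maximal_codewords_def by blast
  then have "card (facets \<Delta>) \<le> 1" using card_mono[of "{{1..n}}"] by fastforce
  then show False using two_facets by simp
qed

section \<open>Combinatorics of the cone and of \<open>S_code\<close>\<close>

lemma cone_mono: "\<sigma> \<in> cone_over n \<Delta> \<Longrightarrow> \<tau> \<subseteq> \<sigma> \<Longrightarrow> \<tau> \<in> cone_over n \<Delta>"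
  using complex_mono[of "\<sigma> - {n+1}" "\<tau> - {n+1}"] by (auto simp: cone_over_def)

lemma insert_apex_in_cone: "\<sigma> \<in> \<Delta> \<Longrightarrow> insert (n+1) \<sigma> \<in> cone_over n \<Delta>"
  using complex_sub[of \<sigma>] complex_mono[of \<sigma> "insert (n+1) \<sigma> - {n+1}"]
  by (auto simp: cone_over_def)

lemma finite_cone: "finite (cone_over n \<Delta>)"
  by (rule finite_subset[of _ "Pow {1..n+1}"]) (auto simp: cone_over_def)

lemma is_code_S_code: "is_code (n + 1) (S_code n \<Delta>)"
  using empty_in_complex by (auto simp: is_code_def S_code_def cone_over_def)

text \<open>An intersection with a member of the cone is a subset of it; otherwise both codewords
  are \<open>{1..n}\<close>.\<close>

lemma intersection_complete_S_code: "intersection_complete (S_code n \<Delta>)"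
  unfolding intersection_complete_def S_code_def
  using cone_mono by (auto intro: cone_mono)

lemma full_notin_cone:
  assumes "{1..n} \<subseteq> \<sigma>" shows "\<sigma> \<notin> cone_over n \<Delta>"
proof
  assume "\<sigma> \<in> cone_over n \<Delta>"
  then have "\<sigma> - {n+1} \<in> \<Delta>" by (simp add: cone_over_def)
  then show False using complex_mono[of "\<sigma> - {n+1}" "{1..n}"] full_notin_complex assms
    by (auto simp: subset_iff)
qed

text \<open>Each member of the cone lies in a facet with the apex added, and no member of the cone
  contains \<open>{1..n}\<close>.\<close>

lemma maximal_codewords_S_code:
  "maximal_codewords (S_code n \<Delta>) = insert {1..n} (insert (n+1) ` facets \<Delta>)"
proof (intro equalityI subsetI)
  fix \<sigma> assume \<sigma>: "\<sigma> \<in> maximal_codewords (S_code n \<Delta>)"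
  show "\<sigma> \<in> insert {1..n} (insert (n+1) ` facets \<Delta>)"
  proof (cases "\<sigma> = {1..n}")
    case False
    then have "\<sigma> - {n+1} \<in> \<Delta>"
      using \<sigma> by (auto simp: maximal_codewords_def S_code_def cone_over_def)
    then obtain \<tau> where \<tau>: "\<tau> \<in> facets \<Delta>" "\<sigma> - {n+1} \<subseteq> \<tau>" using ex_facet by blast
    have "insert (n+1) \<tau> \<in> S_code n \<Delta>"
      using insert_apex_in_cone \<tau> facets_sub by (auto simp: S_code_def)
    then have "\<sigma> = insert (n+1) \<tau>" using \<sigma> \<tau> by (auto simp: maximal_codewords_def)
    then show ?thesis using \<tau> by blast
  qed auto
next
  fix \<sigma> assume "\<sigma> \<in> insert {1..n} (insert (n+1) ` facets \<Delta>)"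
  then consider "\<sigma> = {1..n}" | \<tau> where "\<tau> \<in> facets \<Delta>" "\<sigma> = insert (n+1) \<tau>" by blast
  then show "\<sigma> \<in> maximal_codewords (S_code n \<Delta>)"
  proof cases
    case 1
    then show ?thesis using full_notin_cone by (auto simp: maximal_codewords_def S_code_def)
  next
    case 2
    have "\<rho> = \<sigma>" if "\<rho> \<in> S_code n \<Delta>" "\<sigma> \<subseteq> \<rho>" for \<rho>
    proof -
      have "n + 1 \<in> \<rho>" using that 2 by blast
      then have "\<rho> - {n+1} \<in> \<Delta>" using that by (auto simp: S_code_def cone_over_def)
      moreover have "\<tau> \<subseteq> \<rho> - {n+1}" using that 2 apex_notin_facet by blast
      ultimately have "\<rho> - {n+1} = \<tau>" using 2 by (auto simp: maximal_codewords_def)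
      then show ?thesis using \<open>n + 1 \<in> \<rho>\<close> 2 by blast
    qed
    moreover have "\<sigma> \<in> S_code n \<Delta>"
      using insert_apex_in_cone 2 facets_sub by (auto simp: S_code_def)
    ultimately show ?thesis by (auto simp: maximal_codewords_def)
  qed
qed

lemma finite_facets: "finite (facets \<Delta>)"
  using facets_sub finite_complex finite_subset by blast

lemma card_maximal_codewords_S_code:
  "card (maximal_codewords (S_code n \<Delta>)) = card (facets \<Delta>) + 1"
proof -
  have "inj_on (insert (n+1)) (facets \<Delta>)"
    by (intro inj_onI) (metis Diff_insert_absorb apex_notin_facet)
  then have "card (insert (n+1) ` facets \<Delta>) = card (facets \<Delta>)" by (rule card_image)
  moreover have "n + 1 \<notin> {1..n}" by simp
  then have "{1..n} \<notin> insert (n+1) ` facets \<Delta>" by blast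
  ultimately show ?thesis
    unfolding maximal_codewords_S_code by (simp add: finite_facets)
qed

section \<open>The lower bound on the dimension\<close>

text \<open>With more facets than dimensions, \<open>sunflower_center_meets\<close> would give a
  codeword containing both \<open>{1..n}\<close> and the apex.\<close>

lemma realizable_dimension_ge:
  assumes "open_convex_realizable d (S_code n \<Delta>)"
  shows "card (facets \<Delta>) \<le> d"
proof (rule ccontr)
  assume "\<not> card (facets \<Delta>) \<le> d"
  then have less: "d < card (facets \<Delta>)" by simp
  let ?E = "topspace (Euclidean_space d)"
  obtain N U where U: "\<And>i. i \<in> {1..N} \<Longrightarrow> open_convex d (U i)"
    and code: "S_code n \<Delta> = code_of d N U"
    using assms unfolding open_convex_realizable_def open_convex_def by metis
  define cw where "cw x = {i \<in> {1..N}. x \<in> U i}" for x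
  have cw_in: "cw x \<in> S_code n \<Delta>" if "x \<in> ?E" for x
    using that unfolding code code_of_eq cw_def by blast
  have cw_ex: "\<exists>x\<in>?E. \<sigma> = cw x" if "\<sigma> \<in> S_code n \<Delta>" for \<sigma>
    using that unfolding code code_of_eq cw_def by blast
  \<comment> \<open>The number \<open>N\<close> of sets is not prescribed; indices are in range
    because some codeword uses them.\<close>
  have in_range: "\<sigma> \<subseteq> {1..N}" if "\<sigma> \<in> S_code n \<Delta>" for \<sigma>
    using cw_ex[OF that] unfolding cw_def by auto
  have full: "{1..n} \<in> S_code n \<Delta>" by (simp add: S_code_def)
  have facet: "insert (n+1) F \<in> S_code n \<Delta>" if "F \<in> facets \<Delta>" for F
    using insert_apex_in_cone that facets_sub by (auto simp: S_code_def)
  have apex: "n + 1 \<in> {1..N}"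
    using in_range[of "{n+1}"] insert_apex_in_cone[OF empty_in_complex] by (auto simp: S_code_def)
  define V where "V = common_part d U {1..n}"
  define W where "W F = common_part d U F" for F
  have part_oc: "open_convex d (common_part d U \<sigma>)" if "\<sigma> \<in> S_code n \<Delta>" for \<sigma>
    unfolding common_part_def
    using in_range[OF that] U by (intro open_convex_Inter) (auto intro: finite_subset)
  have part_iff: "x \<in> common_part d U \<sigma> \<longleftrightarrow> x \<in> ?E \<and> \<sigma> \<subseteq> cw x"
    if "\<sigma> \<subseteq> {1..N}" for x \<sigma>
    using that unfolding common_part_def cw_def by blast
  have facet_range: "F \<subseteq> {1..N}" if "F \<in> facets \<Delta>" for F
    using in_range[OF facet[OF that]] by blast
  have facet_code: "F \<in> S_code n \<Delta>" if "F \<in> facets \<Delta>" for F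
    using cone_mono[OF insert_apex_in_cone[of F], of F] that facets_sub by (auto simp: S_code_def)
  have "\<exists>x. x \<in> U (n+1) \<inter> W F" if F: "F \<in> facets \<Delta>" for F
  proof -
    obtain x where "x \<in> ?E" "insert (n+1) F = cw x" using cw_ex[OF facet[OF F]] by blast
    then show ?thesis
      using part_iff[OF facet_range[OF F], of x] unfolding W_def cw_def by blast
  qed
  then obtain p where p: "\<And>F. F \<in> facets \<Delta> \<Longrightarrow> p F \<in> U (n+1) \<inter> W F" by metis
  obtain v where v: "v \<in> V"
    using cw_ex[OF full] part_iff[OF in_range[OF full]] unfolding V_def by blast
  have "U (n+1) \<inter> V \<noteq> {}"
  proof (rule sunflower_center_meets[OF finite_facets less _ v])
    show "open_convex d V" unfolding V_def using part_oc full by blast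
    show "open_convex d (U (n+1))" using U apex by blast
    show "p F \<in> U (n+1) \<inter> W F" if "F \<in> facets \<Delta>" for F using p that by blast
    fix F assume F: "F \<in> facets \<Delta>"
    then have "open_convex d (W F)" unfolding W_def using part_oc facet_code by blast
    then show "convex_seq (W F)" by (simp add: open_convex_def)
    show "W F \<subseteq> ?E" by (auto simp: W_def common_part_def)
    have "F \<subseteq> {1..n}" using F facets_sub complex_sub by blast
    then show "V \<subseteq> W F" unfolding V_def W_def common_part_def by blast
    fix G assume G: "G \<in> facets \<Delta>" and "F \<noteq> G"
    show "W F \<inter> W G \<subseteq> V"
    proof
      fix x assume "x \<in> W F \<inter> W G"
      then have x: "x \<in> ?E" "F \<union> G \<subseteq> cw x"
        using part_iff[OF facet_range[OF F], of x] part_iff[OF facet_range[OF G], of x]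
        by (simp_all add: W_def)
      \<comment> \<open>Without the apex, a member of the cone is a face, and a face containing a
        facet equals it, so it cannot contain two.\<close>
      have "cw x \<notin> cone_over n \<Delta>"
      proof
        assume "cw x \<in> cone_over n \<Delta>"
        then have "cw x - {n+1} \<in> \<Delta>" by (simp add: cone_over_def)
        moreover have "F \<subseteq> cw x - {n+1}" "G \<subseteq> cw x - {n+1}"
          using x(2) apex_notin_facet[OF F] apex_notin_facet[OF G] by blast+
        ultimately have "F = cw x - {n+1}" "G = cw x - {n+1}"
          using F G unfolding maximal_codewords_def by blast+
        then show False using \<open>F \<noteq> G\<close> by blast
      qed
      then have "cw x = {1..n}" using cw_in[OF x(1)] unfolding S_code_def by blast
      then show "x \<in> V" using part_iff[OF in_range[OF full], of x] x(1) unfolding V_def by blast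
    qed
  qed
  then obtain x where x: "x \<in> U (n+1)" "x \<in> V" by blast
  then have "x \<in> ?E" "{1..n} \<subseteq> cw x" using part_iff[OF in_range[OF full]] unfolding V_def by auto
  moreover have "n + 1 \<in> cw x" using x apex by (simp add: cw_def)
  ultimately show False
    using cw_in[of x] full_notin_cone[of "cw x"] by (auto simp: S_code_def)
qed

section \<open>A realization with one dimension per facet\<close>

lemma realizable_card_facets: "open_convex_realizable (card (facets \<Delta>)) (S_code n \<Delta>)"
proof -
  define m where "m = card (facets \<Delta>)"
  have m2: "m \<ge> 2" using two_facets by (simp add: m_def)
  let ?E = "topspace (Euclidean_space m)"
  obtain F where "bij_betw F {..<m} (facets \<Delta>)"
    using ex_bij_betw_nat_finite[OF finite_facets] unfolding m_def atLeast0LessThan by blast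
  then have F_range: "F ` {..<m} = facets \<Delta>" by (simp add: bij_betw_def)
  have F_complex: "F j \<in> \<Delta>" if "j < m" for j using that F_range facets_sub by blast
  obtain idx :: "nat set \<Rightarrow> nat" where idx: "inj_on idx (cone_over n \<Delta>)"
    using finite_imp_inj_to_nat_seg[OF finite_cone] by blast
  \<comment> \<open>Distinct parameters in the open unit interval, one for each member of the
    cone.\<close>
  define t where "t \<sigma> = 1 / (real (idx \<sigma>) + 2)" for \<sigma>
  have t: "0 < t \<sigma>" "t \<sigma> < 1" for \<sigma> by (simp_all add: t_def)
  have t_inj: "\<sigma> = \<tau>" if "\<sigma> \<in> cone_over n \<Delta>" "\<tau> \<in> cone_over n \<Delta>" "t \<sigma> = t \<tau>" for \<sigma> \<tau>
    using that idx by (auto simp: t_def inj_on_def)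
  have "\<exists>j<m. \<sigma> \<subseteq> insert (n+1) (F j)" if \<sigma>: "\<sigma> \<in> cone_over n \<Delta>" for \<sigma>
  proof -
    obtain \<tau> where "\<tau> \<in> facets \<Delta>" "\<sigma> - {n+1} \<subseteq> \<tau>"
      using ex_facet[of "\<sigma> - {n+1}"] \<sigma> unfolding cone_over_def by blast
    moreover from this obtain j where "j < m" "\<tau> = F j"
      using F_range by (metis imageE lessThan_iff)
    ultimately show ?thesis by blast
  qed
  then obtain f where f: "\<And>\<sigma>. \<sigma> \<in> cone_over n \<Delta> \<Longrightarrow> f \<sigma> < m \<and> \<sigma> \<subseteq> insert (n+1) (F (f \<sigma>))"
    by metis
  \<comment> \<open>A second axis for the plane of the parabola; it exists because
    \<open>m \<ge> 2\<close>.\<close>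
  define other where "other j = (if j = 0 then 1 else 0::nat)" for j :: nat
  have other: "other j \<noteq> j" "other j < m" for j using m2 by (auto simp: other_def)
  \<comment> \<open>\<open>base\<close> below is the codeword read off from the signs of the coordinates and of their sum: an
    intersection of facets or \<open>{1..n}\<close>, up to the apex. To obtain all faces, each \<open>\<sigma>\<close> in the cone gets a half-space
    (the complement of \<open>off \<sigma>\<close>) that is removed from every \<open>U i\<close> with \<open>i \<notin> \<sigma>\<close>. It is bounded by the
    tangent of a parabola \<open>x\<^sub>j = x\<^sub>k\<^sup>2 - C\<close> at a point that depends on \<open>\<sigma>\<close>, so it contains no witness
    of another face. The half-spaces may overlap, as this only yields further faces.\<close>
  define C where "C = real m + 2"
  define \<phi> where "\<phi> \<sigma> x = 2 * t \<sigma> * x (other (f \<sigma>)) - x (f \<sigma>)" for \<sigma> and x :: "nat \<Rightarrow> real"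
  define off where "off \<sigma> = {x \<in> ?E. \<phi> \<sigma> x < (t \<sigma>)\<^sup>2 + C}" for \<sigma>
  define pos where "pos j = {x \<in> ?E. 0 < x j}" for j
  define neg where "neg = {x \<in> ?E. (\<Sum>j<m. x j) < 0}"
  define H where "H i = (if i = n + 1 then {neg} else pos ` {j. j < m \<and> i \<notin> F j})
      \<union> off ` {\<sigma> \<in> cone_over n \<Delta>. i \<notin> \<sigma>}" for i
  define U where "U i = ?E \<inter> (\<Inter>A\<in>H i. A)" for i
  have oc_off: "open_convex m (off \<sigma>)" if "\<sigma> \<in> cone_over n \<Delta>" for \<sigma>
  proof -
    have lt: "f \<sigma> < m" using f that by blast
    define a where "a = (\<lambda>i. (if i = other (f \<sigma>) then 2 * t \<sigma> else 0) - (if i = f \<sigma> then 1 else 0))"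
    have "(\<Sum>i<m. a i * x i) = \<phi> \<sigma> x" for x :: "nat \<Rightarrow> real"
      using lt other(2)[of "f \<sigma>"]
      by (simp add: a_def \<phi>_def left_diff_distrib sum_subtractf if_distrib[of "\<lambda>y. y * _"] cong: if_cong)
    then show ?thesis
      using open_convex_half_space[of m a "(t \<sigma>)\<^sup>2 + C"] by (simp add: off_def)
  qed
  have oc_pos: "open_convex m (pos j)" if "j < m" for j
  proof -
    have "(\<Sum>i<m. (if i = j then -1 else 0) * x i) = - x j" for x :: "nat \<Rightarrow> real"
      using that by (simp add: if_distrib[of "\<lambda>y. y * _"] cong: if_cong)
    then show ?thesis
      using open_convex_half_space[of m "\<lambda>i. if i = j then -1 else 0" 0] by (simp add: pos_def)
  qed
  have oc_neg: "open_convex m neg"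
    using open_convex_half_space[of m "\<lambda>_. 1" 0] by (simp add: neg_def)
  have oc_U: "open_convex m (U i)" for i
    unfolding U_def H_def using finite_cone
    by (intro open_convex_Inter) (auto simp: oc_neg oc_pos oc_off split: if_splits)
  \<comment> \<open>\<open>J x\<close> lists the facets and \<open>K x\<close> the cone members that
    restrict the codeword of \<open>x\<close>.\<close>
  define J where "J x = {j. j < m \<and> x j \<le> 0}" for x :: "nat \<Rightarrow> real"
  define K where "K x = {\<sigma> \<in> cone_over n \<Delta>. x \<notin> off \<sigma>}" for x
  define base where "base x = {i \<in> {1..n}. \<forall>j\<in>J x. i \<in> F j} \<union> (if x \<in> neg then {n+1} else {})" for x
  define cw where "cw x = {i \<in> {1..n+1}. x \<in> U i}" for x
  have cw_eq: "cw x = {i \<in> base x. \<forall>\<sigma>\<in>K x. i \<in> \<sigma>}" if "x \<in> ?E" for x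
  proof -
    have "x \<in> pos j \<longleftrightarrow> \<not> x j \<le> 0" for j using that by (auto simp: pos_def)
    then have "x \<in> U i \<longleftrightarrow> (if i = n + 1 then x \<in> neg else \<forall>j\<in>J x. i \<in> F j) \<and> (\<forall>\<sigma>\<in>K x. i \<in> \<sigma>)" for i
      using that unfolding U_def H_def K_def J_def by auto
    then show ?thesis unfolding cw_def base_def by auto
  qed
  have cw_in: "cw x \<in> S_code n \<Delta>" if x: "x \<in> ?E" for x
  proof (cases "J x = {} \<and> K x = {}")
    \<comment> \<open>With all coordinates positive, \<open>x\<close> cannot be in
      \<open>neg\<close>, so \<open>{1..n}\<close> occurs only without the apex.\<close>
    case True
    have "(\<Sum>j<m. x j) \<ge> 0"
      using True by (intro sum_nonneg) (auto simp: J_def not_le intro: less_imp_le)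
    then have "x \<notin> neg" by (simp add: neg_def)
    then have "cw x = {1..n}" using cw_eq[OF x] True by (auto simp: base_def)
    then show ?thesis by (simp add: S_code_def)
  next
    case False
    then consider \<sigma> where "\<sigma> \<in> K x" | j where "j \<in> J x" by blast
    then have "cw x \<in> cone_over n \<Delta>"
    proof cases
      case 1
      then have "cw x \<subseteq> \<sigma>" "\<sigma> \<in> cone_over n \<Delta>" using cw_eq[OF x] by (auto simp: K_def)
      then show ?thesis using cone_mono by blast
    next
      case 2
      then have "cw x \<subseteq> insert (n+1) (F j)"
        using cw_eq[OF x] by (auto simp: base_def split: if_splits)
      moreover have "insert (n+1) (F j) \<in> cone_over n \<Delta>"
        using insert_apex_in_cone F_complex 2 by (auto simp: J_def)
      ultimately show ?thesis using cone_mono by blast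
    qed
    then show ?thesis by (simp add: S_code_def)
  qed
  have t_sq: "(t \<sigma>)\<^sup>2 < 1" "0 < (t \<sigma>)\<^sup>2" for \<sigma>
    using t[of \<sigma>] by (simp_all add: power_less_one_iff abs_square_less_1)
  have full_ex: "{1..n} \<in> cw ` ?E"
  proof -
    \<comment> \<open>All coordinates are positive and \<open>C\<close> is large, so neither a facet
      nor a half-space restricts the codeword.\<close>
    define q where "q i = (if i < m then 1 else 0 :: real)" for i
    have q: "q \<in> ?E" by (simp add: q_def)
    have "q \<in> off \<sigma>" if "\<sigma> \<in> cone_over n \<Delta>" for \<sigma>
    proof -
      have "\<phi> \<sigma> q = 2 * t \<sigma> - 1" using f[OF that] other(2) by (simp add: \<phi>_def q_def)
      then have "\<phi> \<sigma> q < (t \<sigma>)\<^sup>2 + C"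
        using t[of \<sigma>] t_sq[of \<sigma>] of_nat_0_le_iff[of m, where 'a = real] unfolding C_def by linarith
      then show ?thesis using q by (simp add: off_def)
    qed
    then have "K q = {}" by (auto simp: K_def)
    moreover have "J q = {}" by (auto simp: J_def q_def)
    moreover have "q \<notin> neg" by (simp add: neg_def q_def)
    ultimately have "cw q = {1..n}" using cw_eq[OF q] by (auto simp: base_def)
    then show ?thesis using q by blast
  qed
  have cone_ex: "\<sigma> \<in> cw ` ?E" if \<sigma>: "\<sigma> \<in> cone_over n \<Delta>" for \<sigma>
  proof -
    \<comment> \<open>In the plane of \<open>f \<sigma>\<close> and
      \<open>other (f \<sigma>)\<close> this is the point of tangency with parameter
      \<open>t \<sigma>\<close>. As \<open>C = m + 2\<close>, the one negative coordinate outweighs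
      all others and puts \<open>p\<close> in \<open>neg\<close>.\<close>
    define p where "p i = (if i = f \<sigma> then (t \<sigma>)\<^sup>2 - C else if i < m then t \<sigma> else 0)" for i
    have fm: "f \<sigma> < m" using f \<sigma> by blast
    have p: "p \<in> ?E" using fm by (auto simp: p_def)
    have "J p = {f \<sigma>}"
      using fm t[of \<sigma>] t_sq[of \<sigma>] by (auto simp: J_def p_def C_def)
    moreover have "p \<in> neg"
    proof -
      have "(\<Sum>j<m. p j) = p (f \<sigma>) + (\<Sum>j\<in>{..<m} - {f \<sigma>}. p j)"
        using fm by (simp add: sum.remove)
      also have "(\<Sum>j\<in>{..<m} - {f \<sigma>}. p j) \<le> (\<Sum>j\<in>{..<m} - {f \<sigma>}. 1)"
        using t[of \<sigma>] by (intro sum_mono) (auto simp: p_def less_imp_le)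
      also have "\<dots> \<le> real m" using fm by simp
      also have "p (f \<sigma>) + real m < 0" using t_sq[of \<sigma>] by (simp add: p_def C_def)
      finally show ?thesis using p by (simp add: neg_def)
    qed
    moreover have "K p = {\<sigma>}"
    proof -
      have "\<phi> \<sigma> p = (t \<sigma>)\<^sup>2 + C"
        using fm other[of "f \<sigma>"] by (simp add: \<phi>_def p_def power2_eq_square)
      then have "p \<notin> off \<sigma>" by (simp add: off_def)
      moreover have "p \<in> off \<tau>" if \<tau>: "\<tau> \<in> cone_over n \<Delta>" "\<tau> \<noteq> \<sigma>" for \<tau>
      proof -
        have fm': "f \<tau> < m" using f \<tau> by blast
        have "\<phi> \<tau> p < (t \<tau>)\<^sup>2 + C"
        proof (cases "f \<tau> = f \<sigma>")
          case True
          \<comment> \<open>On the same parabola, this square is exactly the gap between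
            \<open>\<phi> \<tau> p\<close> and the bound defining \<open>off \<tau>\<close>.\<close>
          have "(t \<sigma> - t \<tau>)\<^sup>2 > 0" using t_inj[of \<sigma> \<tau>] \<sigma> \<tau> by auto
          moreover have "\<phi> \<tau> p = 2 * t \<tau> * t \<sigma> - (t \<sigma>)\<^sup>2 + C"
            using True other[of "f \<sigma>"] by (simp add: \<phi>_def p_def)
          ultimately show ?thesis by (simp add: power2_diff mult_ac)
        next
          case False
          \<comment> \<open>Coordinate \<open>f \<tau>\<close> of \<open>p\<close> is now positive,
            so \<open>\<phi> \<tau> p\<close> is below 2, hence below \<open>C\<close>.\<close>
          have "p (other (f \<tau>)) \<le> 1"
            using t[of \<sigma>] t_sq[of \<sigma>] by (auto simp: p_def C_def less_imp_le)
          then have "2 * t \<tau> * p (other (f \<tau>)) \<le> 2"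
            using t[of \<tau>] mult_left_le[of "p (other (f \<tau>))" "2 * t \<tau>"] by linarith
          moreover have "p (f \<tau>) > 0" using False fm' t by (simp add: p_def)
          ultimately show ?thesis using t_sq[of \<tau>] unfolding \<phi>_def C_def by linarith
        qed
        then show ?thesis using p by (simp add: off_def)
      qed
      ultimately show ?thesis using \<sigma> by (auto simp: K_def)
    qed
    \<comment> \<open>The nonpositive coordinate leaves \<open>F (f \<sigma>)\<close>,
      \<open>neg\<close> adds the apex, and \<open>K p\<close> cuts down to
      \<open>\<sigma>\<close>.\<close>
    ultimately have "cw p = {i \<in> insert (n+1) ({1..n} \<inter> F (f \<sigma>)). i \<in> \<sigma>}"
      using cw_eq[OF p] by (auto simp: base_def)
    also have "\<dots> = \<sigma>"
      using f[OF \<sigma>] complex_sub[OF F_complex[OF fm]] by blast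
    finally show ?thesis using p by blast
  qed
  have "S_code n \<Delta> = code_of m (n+1) U"
    unfolding code_of_eq cw_def[symmetric]
  proof
    show "cw ` ?E \<subseteq> S_code n \<Delta>" using cw_in by blast
    show "S_code n \<Delta> \<subseteq> cw ` ?E" unfolding S_code_def using full_ex cone_ex by blast
  qed
  then show ?thesis
    using oc_U unfolding open_convex_realizable_def open_convex_def m_def
    by (intro exI[of _ "n+1"] exI[of _ U] conjI ballI) simp_all
qed

lemma odim_S_code: "odim (S_code n \<Delta>) = enat (card (facets \<Delta>))"
  unfolding odim_def
proof (rule antisym)
  show "Inf {enat d |d. open_convex_realizable d (S_code n \<Delta>)} \<le> enat (card (facets \<Delta>))"
    using realizable_card_facets by (intro Inf_lower) blast
  show "enat (card (facets \<Delta>)) \<le> Inf {enat d |d. open_convex_realizable d (S_code n \<Delta>)}"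
    using realizable_dimension_ge by (intro Inf_greatest) auto
qed

end

theorem theorem1p9:
  fixes n m :: nat and \<Delta> :: "nat set set"
  assumes "simplicial_complex_on n \<Delta>"
    and "card (facets \<Delta>) = m"
    and "m \<ge> 2"
  shows "is_code (n + 1) (S_code n \<Delta>)
    \<and> intersection_complete (S_code n \<Delta>)
    \<and> card (maximal_codewords (S_code n \<Delta>)) = m + 1
    \<and> odim (S_code n \<Delta>) = enat m"
  using is_code_S_code[OF assms(1)] intersection_complete_S_code[OF assms(1)]
    card_maximal_codewords_S_code[OF assms(1)] odim_S_code[OF assms(1)] assms(2,3)
  by simp

end
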